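(* Let $n\ge1$ be an integer, let $c\in\mathbb{R}^n$ and let $\rho$ be a real number with $0<\rho\le n$. Let $$B_\rho:=\{j\in\mathbb{Z},\ j\ge 0:\ D_c(\tau)>\rho\ \text{ for all } \tau\in I_j\}.$$ Then $$|B_\rho|\ \le\ n\log_2(n/\rho)$$ (in particular, $B_\rho$ is finite).
   Context: For integers $j\ge0$, $I_j:=[2^{-j-1},2^{-j}]\subseteq\mathbb{R}$. For $c\in\mathbb{R}^n$ and $\tau\in\mathbb{R}$, $D_c(\tau):=\min_{z\in\mathbb{Z}^n}\lVert\tau c-z\rVert_1$ is the $\ell_1$-distance of $\tau c$ to $\mathbb{Z}^n$. *)

theory Defs
  imports "HOL-Analysis.Analysis"
begin

definition l1_norm :: "real ^ 'n \<Rightarrow> real"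
  where "l1_norm x = (\<Sum>i\<in>UNIV. \<bar>x $ i\<bar>)"

definition int_lattice :: "(real ^ 'n) set"
  where "int_lattice = {z. \<forall>i. z $ i \<in> \<int>}"

(* Written as an infimum; the lemma int_dist_attained below shows that it is a minimum. *)
definition int_dist :: "real ^ 'n \<Rightarrow> real \<Rightarrow> real"
  where "int_dist c \<tau> = (INF z\<in>int_lattice. l1_norm (\<tau> *\<^sub>R c - z))"

definition dyadic_interval :: "nat \<Rightarrow> real set"
  where "dyadic_interval j = {1 / 2 ^ (j + 1) .. 1 / 2 ^ j}"

definition bad_scales :: "real ^ 'n \<Rightarrow> real \<Rightarrow> nat set"
  where "bad_scales c \<rho> = {j. \<forall>\<tau>\<in>dyadic_interval j. int_dist c \<tau> > \<rho>}"

lemma int_dist_attained: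
  fixes c :: "real ^ 'n" and \<tau> :: real
  shows "\<exists>z\<in>int_lattice. int_dist c \<tau> = l1_norm (\<tau> *\<^sub>R c - z)
           \<and> (\<forall>w\<in>int_lattice. l1_norm (\<tau> *\<^sub>R c - z) \<le> l1_norm (\<tau> *\<^sub>R c - w))"
proof -
  define z :: "real ^ 'n" where "z = (\<chi> i. of_int (round (\<tau> * c $ i)))"
  have z: "z \<in> int_lattice"
    by (simp add: z_def int_lattice_def)
  have le: "l1_norm (\<tau> *\<^sub>R c - z) \<le> l1_norm (\<tau> *\<^sub>R c - w)" if "w \<in> int_lattice" for w
    unfolding l1_norm_def
  proof (rule sum_mono)
    fix i
    have "w $ i \<in> \<int>"
      using that by (simp add: int_lattice_def)
    then obtain k where k: "w $ i = of_int k"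
      by (rule Ints_cases)
    show "\<bar>(\<tau> *\<^sub>R c - z) $ i\<bar> \<le> \<bar>(\<tau> *\<^sub>R c - w) $ i\<bar>"
      using round_diff_minimal[of "\<tau> * c $ i" k] by (simp add: z_def k)
  qed
  have "int_dist c \<tau> = l1_norm (\<tau> *\<^sub>R c - z)"
    unfolding int_dist_def by (rule cInf_eq_minimum) (use z le in auto)
  then show ?thesis using z le by blast
qed

end

theory Submission
  imports Defs
begin

text \<open>
  Write \<open>s = \<rho> / n\<close>. For a box \<open>Q\<close> of side \<open>s\<close> in the torus, any two times \<open>t, t'\<close> at which
  \<open>t c\<close> and \<open>t' c\<close> lie in \<open>Q\<close> satisfy \<open>D\<^sub>c(t - t') \<le> n s = \<rho>\<close>, so \<open>t - t'\<close> lies in no interval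
  \<open>I\<^sub>j\<close> with \<open>j\<close> bad. Call a time captured if its point lies in \<open>Q\<close>. Two opposite
  estimates for the number of captured times among the multiples of \<open>2\<^sup>-\<^sup>J\<close> in \<open>[0, 1)\<close> give the
  bound.

  From below (\<open>exists_subset_close_mod_1\<close>): averaging over the position of \<open>Q\<close>, one coordinate at
  a time, some box captures at least a proportion \<open>s\<^sup>n\<close> of the \<open>2\<^sup>J\<close> times.

  From above (\<open>card_avoiding_dyadic_differences\<close>): among the captured times in a window of length
  \<open>2\<^sup>-\<^sup>j\<close>, no two differ by an element of \<open>I\<^sub>j\<close> if \<open>j\<close> is bad, so they all lie in a window of half
  that length. Passing from scale \<open>j\<close> to scale \<open>j + 1\<close> thus costs nothing when \<open>j\<close> is bad and at
  most a factor 2 otherwise; hence with \<open>b\<close> bad scales below \<open>J\<close> at most \<open>2\<^sup>J / 2\<^sup>b\<close> times are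
  captured.

  Together \<open>s\<^sup>n \<le> 1 / 2\<^sup>b\<close>, that is \<open>b \<le> n log\<^sub>2 (n / \<rho>)\<close>.
\<close>

section \<open>Points of a set in a common box of the torus\<close>

text \<open>The fractional part of \<open>y - x\<close> is at most \<open>s\<close> when the arc \<open>[x, x + s]\<close> modulo 1 contains
  \<open>y\<close>. The arcs counted here start at the grid points \<open>p / M\<close> that precede \<open>y\<close> most closely.\<close>

lemma card_grid_frac_le:
  fixes y s :: real
  assumes "0 < M" and "s \<le> 1"
  shows "s * real M - 1 \<le> real (card {p\<in>{..<M}. frac (y - real p / real M) \<le> s})"
proof -
  define K where "K = nat \<lfloor>s * real M\<rfloor>"
  \<comment> \<open>\<open>h q / M\<close> is, modulo 1, the grid point that lies \<open>q\<close> steps before the last one up to \<open>y\<close>.\<close>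
  define h where "h q = nat ((\<lfloor>y * M\<rfloor> - int q) mod int M)" for q
  have M: "0 < real M" using assms by simp
  have K_le: "real q + 1 \<le> s * M" if "q < K" for q
  proof -
    have "int q + 1 \<le> \<lfloor>s * real M\<rfloor>" using that unfolding K_def by linarith
    then show ?thesis by linarith
  qed
  have sM: "s * M \<le> M" using assms by (simp add: mult_left_le_one_le mult_le_cancel_right1)
  have q_less: "q < M" if "q < K" for q
    using K_le[OF that] sM by linarith
  have h_int: "int (h q) = (\<lfloor>y * M\<rfloor> - int q) mod int M" for q
    using assms by (simp add: h_def)
  have inj: "inj_on h {..<K}"
  proof (rule inj_onI)
    fix q q' assume q: "q \<in> {..<K}" "q' \<in> {..<K}" and "h q = h q'"
    then have "(\<lfloor>y * M\<rfloor> - int q) mod int M = (\<lfloor>y * M\<rfloor> - int q') mod int M"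
      by (metis h_int)
    then have "int M dvd int q' - int q"
      by (simp add: mod_eq_dvd_iff)
    then show "q = q'"
      using q_less[of q] q_less[of q'] q zdvd_imp_le[of "int M" "int q' - int q"]
        zdvd_imp_le[of "int M" "int q - int q'"]
      by (smt (verit) dvd_minus_iff lessThan_iff of_nat_eq_iff of_nat_less_iff of_nat_0_le_iff)
  qed
  have sub: "h ` {..<K} \<subseteq> {p\<in>{..<M}. frac (y - real p / real M) \<le> s}"
  proof safe
    fix q assume q: "q < K"
    have "int (h q) < int M" unfolding h_int using assms by simp
    then show "h q < M" by simp
    obtain k where k: "\<lfloor>y * M\<rfloor> - int q = int (h q) + int M * k"
      by (metis h_int mod_mult_div_eq)
    have "real_of_int \<lfloor>y * M\<rfloor> - real q = real (h q) + real M * of_int k"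
      using arg_cong[OF k, of real_of_int] by simp
    then have eq: "y - real (h q) / M = (frac (y * M) + real q) / M + of_int k"
      using M by (simp add: frac_def field_simps)
    have "frac (y * M) + real q < s * M"
      using K_le[OF q] frac_lt_1[of "y * M"] by linarith
    then have "(frac (y * M) + real q) / M < s"
      using M by (simp add: pos_divide_less_eq)
    then have le: "(frac (y * M) + real q) / M < 1" "(frac (y * M) + real q) / M \<le> s"
      using \<open>s \<le> 1\<close> by linarith+
    have "frac (y - real (h q) / M) = (frac (y * M) + real q) / M"
      unfolding frac_unique_iff using eq le M by simp
    then show "frac (y - real (h q) / M) \<le> s" using le by simp
  qed
  have "K \<le> card {p\<in>{..<M}. frac (y - real p / real M) \<le> s}"
    using card_mono[OF _ sub] by (simp add: card_image[OF inj])
  moreover have "s * M - 1 \<le> real K" unfolding K_def by linarith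
  ultimately show ?thesis by linarith
qed

text \<open>The average over \<open>x\<close> of the number of points in the arc of length \<open>s\<close> starting at \<open>x\<close> is
  \<open>s\<close> times the number of all points; averages over finer and finer grids of positions suffice,
  since the counts are integers.\<close>

lemma exists_popular_arc:
  fixes g :: "'a \<Rightarrow> real" and s :: real
  assumes fin: "finite A" and "s \<le> 1"
  shows "\<exists>x. s * card A \<le> card {a\<in>A. frac (g a - x) \<le> s}"
proof (rule ccontr)
  define N where "N x = card {a\<in>A. frac (g a - x) \<le> s}" for x
  assume "\<not> ?thesis"
  then have less: "real (N x) < s * card A" for x
    by (auto simp: N_def not_le)
  \<comment> \<open>The largest integer below \<open>s * card A\<close>: it leaves a gap that does not depend on \<open>x\<close>.\<close>
  define m where "m = nat (\<lceil>s * card A\<rceil> - 1)"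
  have "N x \<le> m" for x using less[of x] unfolding m_def by linarith
  moreover have m: "real m < s * card A"
    using less[of 0] unfolding m_def by linarith
  ultimately have N_le: "real (N x) \<le> m" for x by simp
  obtain M where M: "real (card A) / (s * card A - m) < real M"
    using reals_Archimedean2 by blast
  then have "0 < real M" using m by (smt (verit) divide_nonneg_pos of_nat_0_le_iff)
  then have M0: "0 < M" by simp
  have "card A * (s * M - 1) \<le> (\<Sum>a\<in>A. real (card {p\<in>{..<M}. frac (g a - real p / M) \<le> s}))"
    by (rule sum_bounded_below) (use card_grid_frac_le[OF M0 \<open>s \<le> 1\<close>] in simp)
  also have "\<dots> = (\<Sum>p<M. real (N (real p / M)))"
    unfolding N_def of_nat_sum[symmetric]
    using sum_multicount_gen[OF fin finite_lessThan[of M],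
        of "\<lambda>a p. frac (g a - real p / M) \<le> s" "\<lambda>p. card {a\<in>A. frac (g a - real p / M) \<le> s}"]
    by simp
  also have "\<dots> \<le> M * m"
    using sum_bounded_above[of "{..<M}" "\<lambda>p. real (N (real p / M))"] N_le by simp
  finally have "M * (s * card A - m) \<le> card A" by (simp add: algebra_simps)
  then show False using M m by (simp add: field_simps)
qed

text \<open>One coordinate \<open>i\<close> at a time, restricting to a popular arc keeps at least a proportion \<open>s\<close> of the
  points and makes the remaining values of \<open>g i\<close> pairwise close modulo 1.\<close>

lemma exists_subset_close_mod_1:
  fixes g :: "'i \<Rightarrow> 'a \<Rightarrow> real" and s :: real
  assumes "finite I" and "finite A" and "0 \<le> s" and "s \<le> 1"
  shows "\<exists>A'\<subseteq>A. s ^ card I * card A \<le> card A' \<and>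
    (\<forall>i\<in>I. \<forall>a\<in>A'. \<forall>b\<in>A'. \<exists>z\<in>\<int>. \<bar>g i b - g i a - z\<bar> \<le> s)"
  using \<open>finite I\<close>
proof induction
  case empty
  then show ?case by auto
next
  case (insert i I)
  then obtain A1 where A1: "A1 \<subseteq> A" "s ^ card I * card A \<le> card A1"
    and close: "\<forall>i\<in>I. \<forall>a\<in>A1. \<forall>b\<in>A1. \<exists>z\<in>\<int>. \<bar>g i b - g i a - z\<bar> \<le> s"
    by blast
  have "finite A1" using A1 \<open>finite A\<close> finite_subset by blast
  then obtain x where x: "s * card A1 \<le> card {a\<in>A1. frac (g i a - x) \<le> s}"
    using exists_popular_arc[OF _ \<open>s \<le> 1\<close>] by blast
  define A2 where "A2 = {a\<in>A1. frac (g i a - x) \<le> s}"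
  have "s ^ card (insert i I) * card A = s * (s ^ card I * card A)"
    using insert by simp
  also have "\<dots> \<le> s * card A1" using A1 \<open>0 \<le> s\<close> by (intro mult_left_mono)
  also have "\<dots> \<le> card A2" using x by (simp add: A2_def)
  finally have "s ^ card (insert i I) * card A \<le> card A2" .
  moreover have "\<exists>z\<in>\<int>. \<bar>g i b - g i a - z\<bar> \<le> s" if "a \<in> A2" "b \<in> A2" for a b
  proof
    let ?z = "of_int (\<lfloor>g i b - x\<rfloor> - \<lfloor>g i a - x\<rfloor>) :: real"
    show "?z \<in> \<int>" by (rule Ints_of_int)
    have "g i b - g i a - ?z = frac (g i b - x) - frac (g i a - x)"
      by (simp add: frac_def)
    then show "\<bar>g i b - g i a - ?z\<bar> \<le> s"
      using that frac_ge_0[of "g i a - x"] frac_ge_0[of "g i b - x"]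
      unfolding A2_def mem_Collect_eq by linarith
  qed
  ultimately show ?case
    using close A1 by (intro exI[of _ A2]) (auto simp: A2_def)
qed

section \<open>Sets that avoid dyadic ranges of differences\<close>

text \<open>For no exponent \<open>r < k\<close> in \<open>R\<close> does a difference of two elements of \<open>A\<close> lie in
  \<open>[2 ^ r, 2 ^ (r + 1)]\<close>. As \<open>b - a\<close> is 0 for \<open>b < a\<close> and \<open>2 ^ r\<close> is positive, the
  truncated subtraction adds no condition.\<close>

lemma card_avoiding_dyadic_differences:
  fixes A R :: "nat set"
  assumes "A \<subseteq> {m..<m + 2 ^ k}"
    and "\<And>a b r. \<lbrakk>a \<in> A; b \<in> A; r \<in> R; r < k; 2 ^ r \<le> b - a\<rbrakk> \<Longrightarrow> 2 ^ (r + 1) < b - a"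
  shows "card A * 2 ^ card (R \<inter> {..<k}) \<le> 2 ^ k"
  using assms
proof (induction k arbitrary: A m)
  case 0
  then show ?case using card_mono[OF _ 0(1)] by simp
next
  case (Suc k)
  have IH: "card A' * 2 ^ card (R \<inter> {..<k}) \<le> 2 ^ k"
    if "A' \<subseteq> A" "A' \<subseteq> {m'..<m' + 2 ^ k}" for A' m'
    by (rule Suc.IH[OF that(2)]) (use that(1) Suc.prems(2) in \<open>meson less_SucI subsetD\<close>)
  have fin: "finite A" using Suc.prems(1) finite_subset by blast
  show ?case
  proof (cases "k \<in> R")
    case True
    \<comment> \<open>No element exceeds \<open>Min A\<close> by \<open>2 ^ k\<close> or more, so \<open>A\<close> fits into a window of half the length.\<close>
    have "A \<subseteq> {Min A..<Min A + 2 ^ k}"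
    proof
      fix b assume b: "b \<in> A"
      then have Min: "Min A \<in> A" "Min A \<le> b" using fin Min_in[of A] by (blast, simp)
      then have "m \<le> Min A" "b < m + 2 ^ (k + 1)" using Suc.prems(1) b by auto
      then have "b - Min A < 2 ^ (k + 1)" using Min by linarith
      then have "b - Min A < 2 ^ k"
        using Suc.prems(2)[OF Min(1) b True] by (meson lessI not_less order_less_imp_le)
      then show "b \<in> {Min A..<Min A + 2 ^ k}" using Min by auto
    qed
    from IH[OF order_refl this] show ?thesis
      using True by (simp add: lessThan_Suc Int_insert_right)
  next
    case False
    define A1 A2 where "A1 = A \<inter> {m..<m + 2 ^ k}" and "A2 = A \<inter> {m + 2 ^ k..<m + 2 ^ k + 2 ^ k}"
    have "A = A1 \<union> A2" using Suc.prems(1) by (auto simp: A1_def A2_def subset_iff)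
    then have "card A \<le> card A1 + card A2" by (simp add: card_Un_le)
    then have "card A * 2 ^ card (R \<inter> {..<k}) \<le>
        card A1 * 2 ^ card (R \<inter> {..<k}) + card A2 * 2 ^ card (R \<inter> {..<k})"
      by (metis add_mult_distrib mult_le_mono1)
    also have "\<dots> \<le> 2 ^ k + 2 ^ k"
      by (intro add_mono IH[of A1 m] IH[of A2 "m + 2 ^ k"]) (auto simp: A1_def A2_def)
    finally show ?thesis
      using False by (simp add: lessThan_Suc Int_insert_right)
  qed
qed

section \<open>Counting bad scales\<close>

lemma int_dist_le:
  assumes "\<And>i. \<exists>z\<in>\<int>. \<bar>\<tau> * c $ i - z\<bar> \<le> s"
  shows "int_dist (c :: real ^ 'n) \<tau> \<le> real CARD('n) * s"
proof -
  obtain z where z: "\<And>i. z i \<in> \<int>" "\<And>i. \<bar>\<tau> * c $ i - z i\<bar> \<le> s"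
    using assms by metis
  have "int_dist c \<tau> \<le> l1_norm (\<tau> *\<^sub>R c - (\<chi> i. z i))"
    unfolding int_dist_def
  proof (rule cINF_lower)
    show "bdd_below ((\<lambda>z. l1_norm (\<tau> *\<^sub>R c - z)) ` int_lattice)"
      by (rule bdd_belowI[of _ 0]) (auto simp: l1_norm_def sum_nonneg)
  qed (simp add: int_lattice_def z)
  also have "\<dots> \<le> real CARD('n) * s"
    unfolding l1_norm_def using sum_bounded_above[of UNIV "\<lambda>i. \<bar>\<tau> * c $ i - z i\<bar>" s] z by simp
  finally show ?thesis .
qed

text \<open>The comparison of the two estimates. It is stated for finite sets \<open>G\<close> of bad scales, since the
  finiteness of the set of all bad scales is itself a consequence.\<close>

lemma power_card_bad_scales_le:
  fixes c :: "real ^ 'n" and \<rho> :: real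
  assumes "0 < \<rho>" and "\<rho> \<le> real CARD('n)" and "finite G" and "G \<subseteq> bad_scales c \<rho>"
  shows "(\<rho> / CARD('n)) ^ CARD('n) * 2 ^ card G \<le> 1"
proof -
  define s where "s = \<rho> / CARD('n)"
  have s: "0 \<le> s" "s \<le> 1" "CARD('n) * s = \<rho>" using assms by (auto simp: s_def)
  obtain J where J: "G \<subseteq> {..<J}"
    using \<open>finite G\<close> finite_nat_iff_bounded by blast
  \<comment> \<open>The integer \<open>a < 2 ^ J\<close> stands for the time \<open>a / 2 ^ J\<close>.\<close>
  define g where "g i a = real a / 2 ^ J * c $ i" for i a
  obtain A where A: "A \<subseteq> {0..<2 ^ J}" "s ^ CARD('n) * 2 ^ J \<le> card A"
    and close: "\<And>i a b. \<lbrakk>a \<in> A; b \<in> A\<rbrakk> \<Longrightarrow> \<exists>z\<in>\<int>. \<bar>g i b - g i a - z\<bar> \<le> s"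
    using exists_subset_close_mod_1[of "UNIV :: 'n set" "{0..<2 ^ J}" s g] s by auto
  \<comment> \<open>In these units \<open>I\<^sub>j\<close> is \<open>[2 ^ r, 2 ^ (r + 1)]\<close> with \<open>r = J - 1 - j\<close>.\<close>
  define R where "R = (\<lambda>j. J - 1 - j) ` G"
  have "inj_on (\<lambda>j. J - 1 - j) G"
  proof (rule inj_onI)
    fix x y assume "x \<in> G" "y \<in> G" "J - 1 - x = J - 1 - y"
    moreover from this have "x < J" "y < J" using J by auto
    ultimately show "x = y" by linarith
  qed
  then have "card R = card G" unfolding R_def by (rule card_image)
  moreover have "R \<inter> {..<J} = R" using J by (fastforce simp: R_def)
  ultimately have R: "card (R \<inter> {..<J}) = card G" by simp
  have "card A * 2 ^ card (R \<inter> {..<J}) \<le> 2 ^ J"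
  proof (rule card_avoiding_dyadic_differences[where m = 0])
    show "A \<subseteq> {0..<0 + 2 ^ J}" using A by simp
    fix a b r assume ab: "a \<in> A" "b \<in> A" and "r \<in> R" and "r < J" and r: "2 ^ r \<le> b - a"
    then obtain j where j: "j \<in> G" "j < J" "r = J - 1 - j" using J by (auto simp: R_def)
    then have J_eq: "J = r + 1 + j" by simp
    define \<tau> where "\<tau> = real (b - a) / 2 ^ J"
    have "a \<le> b" using r by (metis diff_is_0_eq le_zero_eq nat_le_linear power_not_zero zero_neq_numeral)
    then have "\<tau> * c $ i = g i b - g i a" for i
      by (simp add: \<tau>_def g_def of_nat_diff diff_divide_distrib left_diff_distrib)
    then have "int_dist c \<tau> \<le> \<rho>"
      using int_dist_le[of \<tau> c s] close[OF ab] s by simp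
    then have "\<tau> \<notin> dyadic_interval j"
      using j assms(4) unfolding bad_scales_def by fastforce
    moreover have "1 / 2 ^ (j + 1) \<le> \<tau>"
    proof -
      have "(2::real) ^ r \<le> real (b - a)" using r by (metis of_nat_le_iff of_nat_numeral of_nat_power)
      then show ?thesis by (simp add: \<tau>_def J_eq power_add field_simps)
    qed
    ultimately have "1 / 2 ^ j < \<tau>" by (auto simp: dyadic_interval_def)
    then have "(2::real) ^ (r + 1) < real (b - a)"
      by (simp add: \<tau>_def J_eq power_add field_simps)
    then show "2 ^ (r + 1) < b - a"
      by (metis of_nat_less_iff of_nat_numeral of_nat_power)
  qed
  then have "real (card A * 2 ^ card G) \<le> real (2 ^ J)"
    unfolding R by (rule of_nat_mono)
  then have "real (card A) * 2 ^ card G \<le> 2 ^ J" by simp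
  moreover have "s ^ CARD('n) * 2 ^ J * 2 ^ card G \<le> real (card A) * 2 ^ card G"
    using A by (intro mult_right_mono) auto
  ultimately have "s ^ CARD('n) * 2 ^ J * 2 ^ card G \<le> 1 * 2 ^ J" by linarith
  then have "(s ^ CARD('n) * 2 ^ card G) * 2 ^ J \<le> 1 * 2 ^ J"
    by (simp only: mult.assoc mult.commute[of "2 ^ J"])
  then show ?thesis unfolding s_def by (rule mult_right_le_imp_le) simp
qed

theorem theorem5:
  fixes c :: "real ^ 'n" and \<rho> :: real
  assumes "0 < \<rho>" and "\<rho> \<le> real CARD('n)"
  shows "finite (bad_scales c \<rho>) \<and>
    real (card (bad_scales c \<rho>)) \<le> real CARD('n) * log 2 (real CARD('n) / \<rho>)"
proof -
  let ?L = "real CARD('n) * log 2 (real CARD('n) / \<rho>)"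
  have bound: "real (card G) \<le> ?L" if "finite G" "G \<subseteq> bad_scales c \<rho>" for G
  proof -
    have "2 ^ card G \<le> (real CARD('n) / \<rho>) ^ CARD('n)"
      using power_card_bad_scales_le[OF assms that] assms(1)
      by (simp add: power_divide field_simps)
    then have "log 2 (2 ^ card G) \<le> log 2 ((real CARD('n) / \<rho>) ^ CARD('n))"
      using assms(1) by (subst log_le_cancel_iff) auto
    then show ?thesis using assms(1) by (simp add: log_nat_power)
  qed
  have "finite (bad_scales c \<rho>)"
  proof (rule conjunct1[OF finite_if_finite_subsets_card_bdd])
    show "card G \<le> nat \<lfloor>?L\<rfloor>" if "G \<subseteq> bad_scales c \<rho>" "finite G" for G
      using bound[OF that(2,1)] by linarith
  qed
  then show ?thesis using bound by blast
qed

end
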